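(* Let $\Omega$ be a hyperbolic domain in $\mathbb{C}$. Then: (i) $\widehat{C}(\Omega)\le \frac12$. (ii) $\widetilde{C}(\Omega)\le \widehat{C}(\Omega)$ and $\widetilde{C}'(\Omega)\le \widehat{C}'(\Omega)$. (iii) $\widehat{C}(\Omega)\le 2\,C(\Omega)$. (iv) $C(\Omega)\le 4\,\widetilde{C}'(\Omega)=4\,\widetilde{C}(\Omega)/\sigma(\widehat{\mathbb{C}}\setminus\Omega)$.
   Context: $\widehat{\mathbb{C}}=\mathbb{C}\cup\{\infty\}$ is the Riemann sphere and $\mathbb{D}=\{z\in\mathbb{C}:|z|<1\}$. Boundaries $\partial\Omega$ are taken in $\widehat{\mathbb{C}}$. A domain $\Omega\subset\widehat{\mathbb{C}}$ is called hyperbolic if $\partial\Omega$ contains at least three points; a hyperbolic domain in $\mathbb{C}$ is a hyperbolic domain with $\Omega\subset\mathbb{C}$. The hyperbolic metric $\lambda_\Omega(z)|dz|$ (normalized to have curvature $-4$) is determined by $\lambda_{\mathbb{D}}(z)=1/(1-|z|^2)$ and $\lambda_{\mathbb{D}}(z)=\lambda_\Omega(p(z))|p'(z)|$ for $z\in\mathbb{D}$, where $p:\mathbb{D}\to\Omega$ is an analytic universal covering projection. The Euclidean distance to the boundary is $d_\Omega(z)=\min_{a\in\partial\Omega}|z-a|$ (where $|z-\infty|=+\infty$), and $C(\Omega)=\inf_{z\in\Omega}d_\Omega(z)\lambda_\Omega(z)$. The spherical (chordal) distance is $\sigma(z,w)=\dfrac{|z-w|}{\sqrt{(1+|z|^2)(1+|w|^2)}}$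 for $z,w\in\mathbb{C}$ and $\sigma(z,\infty)=1/\sqrt{1+|z|^2}$ for $z\in\mathbb{C}$ (and $\sigma(\infty,\infty)=0$). Also $\tau(z,w)=\left|\dfrac{z-w}{1+z\bar w}\right|$, with values in $[0,+\infty]$; equivalently $\tau(z,w)=\sigma(z,w)/\sqrt{1-\sigma(z,w)^2}$ for all $z,w\in\widehat{\mathbb{C}}$, which is $+\infty$ exactly when $\sigma(z,w)=1$, and which gives $\tau(z,\infty)=1/|z|$. For a set $E\subset\widehat{\mathbb{C}}$, $\sigma(E)=\sup_{z,w\in E}\sigma(z,w)$ denotes its spherical diameter. Put $\delta_\Omega(z)=\min_{a\in\partial\Omega}\sigma(z,a)$, $\varepsilon_\Omega(z)=\min_{a\in\partial\Omega}\tau(z,a)$ for $z\in\Omega$, and let $\mu_\Omega(z)=(1+|z|^2)\lambda_\Omega(z)$ be the spherical density of the hyperbolic metric. Define $$\widetilde{C}(\Omega)=\inf_{z\in\Omega}\delta_\Omega(z)\mu_\Omega(z),\qquad \widehat{C}(\Omega)=\inf_{z\in\Omega}\varepsilon_\Omega(z)\mu_\Omega(z),$$ $$\widetilde{C}'(\Omega)=\frac{\widetilde{C}(\Omega)}{\sigma(\widehat{\mathbb{C}}\setminus\Omega)},\qquad \widehat{C}'(\Omega)=\frac{\widehat{C}(\Omega)}{\sigma(\widehat{\mathbb{C}}\setminus\Omega)}.$$ *)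

theory Defs
  imports "HOL-Complex_Analysis.Complex_Analysis"
begin

section \<open>The Riemann sphere and domains\<close>

text \<open>
  A point of the Riemann sphere is \<open>Some z\<close> with \<open>z\<close> a complex number, or \<open>None\<close>, the point at
  infinity.
\<close>

type_synonym sphere = "complex option"

abbreviation sphere_topology :: "sphere topology" where
  "sphere_topology \<equiv> Alexandroff_compactification (euclidean :: complex topology)"

definition sphere_boundary :: "complex set \<Rightarrow> sphere set" where
  "sphere_boundary \<Omega> = sphere_topology frontier_of (Some ` \<Omega>)"

definition sphere_complement :: "complex set \<Rightarrow> sphere set" where
  "sphere_complement \<Omega> = topspace sphere_topology - Some ` \<Omega>"

definition hyperbolic_domain :: "complex set \<Rightarrow> bool" where
  "hyperbolic_domain \<Omega> \<longleftrightarrow> \<Omega> \<noteq> {} \<and> open \<Omega> \<and> connected \<Omega> \<and>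
     (\<exists>a b c. a \<noteq> b \<and> a \<noteq> c \<and> b \<noteq> c \<and> {a, b, c} \<subseteq> sphere_boundary \<Omega>)"


section \<open>The hyperbolic metric\<close>

text \<open>Every covering by the unit disc is universal, the disc being simply connected.\<close>

definition universal_covering :: "(complex \<Rightarrow> complex) \<Rightarrow> complex set \<Rightarrow> bool" where
  "universal_covering p \<Omega> \<longleftrightarrow> p holomorphic_on ball 0 1 \<and> covering_space (ball 0 1) p \<Omega>"

text \<open>
  The density of curvature \<open>-4\<close> at \<open>w\<close>: the number \<open>l\<close> with \<open>1 / (1 - |z|\<^sup>2) = l |p'(z)|\<close> for every
  analytic universal covering \<open>p\<close> from the disc onto \<open>\<Omega>\<close> and every \<open>z\<close> over \<open>w\<close>. Such a \<open>p\<close> exists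
  for each hyperbolic domain by the uniformization theorem, so the value \<open>0\<close> is only taken for
  \<open>w\<close> outside \<open>\<Omega>\<close> or for \<open>\<Omega>\<close> not hyperbolic.
\<close>

definition hyp_density :: "complex set \<Rightarrow> complex \<Rightarrow> real" where
  "hyp_density \<Omega> w =
     (if \<exists>p z. universal_covering p \<Omega> \<and> z \<in> ball 0 1 \<and> p z = w
      then THE l. \<forall>p z. universal_covering p \<Omega> \<and> z \<in> ball 0 1 \<and> p z = w \<longrightarrow>
                    1 / (1 - (cmod z)\<^sup>2) = l * cmod (deriv p z)
      else 0)"

definition spherical_density :: "complex set \<Rightarrow> complex \<Rightarrow> real" where
  "spherical_density \<Omega> z = (1 + (cmod z)\<^sup>2) * hyp_density \<Omega> z"


section \<open>Distances on the sphere\<close>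

text \<open>
  Distances take values in \<open>[0, \<infinity>]\<close>. In \<^typ>\<open>ennreal\<close> a quotient \<open>x / 0\<close> with \<open>x > 0\<close> is \<open>\<infinity>\<close>, so
  \<open>tau_dist\<close> is \<open>\<infinity>\<close> exactly on pairs of antipodal points.
\<close>

fun eucl_dist :: "complex \<Rightarrow> sphere \<Rightarrow> ennreal" where
  "eucl_dist z (Some a) = ennreal (cmod (z - a))"
| "eucl_dist z None = \<infinity>"

fun chordal_dist :: "sphere \<Rightarrow> sphere \<Rightarrow> real" where
  "chordal_dist (Some z) (Some w) =
     cmod (z - w) / sqrt ((1 + (cmod z)\<^sup>2) * (1 + (cmod w)\<^sup>2))"
| "chordal_dist (Some z) None = 1 / sqrt (1 + (cmod z)\<^sup>2)"
| "chordal_dist None (Some w) = 1 / sqrt (1 + (cmod w)\<^sup>2)"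
| "chordal_dist None None = 0"

fun tau_dist :: "sphere \<Rightarrow> sphere \<Rightarrow> ennreal" where
  "tau_dist (Some z) (Some w) = ennreal (cmod (z - w)) / ennreal (cmod (1 + z * cnj w))"
| "tau_dist (Some z) None = 1 / ennreal (cmod z)"
| "tau_dist None (Some w) = 1 / ennreal (cmod w)"
| "tau_dist None None = 0"

definition chordal_diameter :: "sphere set \<Rightarrow> ennreal" where
  "chordal_diameter E = (SUP z\<in>E. SUP w\<in>E. ennreal (chordal_dist z w))"

text \<open>
  Minima over the boundary are written as infima; since the boundary is compact they are attained.
\<close>

definition eucl_bdist :: "complex set \<Rightarrow> complex \<Rightarrow> ennreal" where
  "eucl_bdist \<Omega> z = (INF a\<in>sphere_boundary \<Omega>. eucl_dist z a)"

definition chordal_bdist :: "complex set \<Rightarrow> complex \<Rightarrow> ennreal" where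
  "chordal_bdist \<Omega> z = (INF a\<in>sphere_boundary \<Omega>. ennreal (chordal_dist (Some z) a))"

definition tau_bdist :: "complex set \<Rightarrow> complex \<Rightarrow> ennreal" where
  "tau_bdist \<Omega> z = (INF a\<in>sphere_boundary \<Omega>. tau_dist (Some z) a)"


section \<open>The domain constants\<close>

text \<open>
  \<open>C_eucl\<close>, \<open>C_tilde\<close>, \<open>C_hat\<close>, \<open>C_tilde'\<close> and \<open>C_hat'\<close> stand for $C$, $\widetilde{C}$, $\widehat{C}$,
  $\widetilde{C}'$ and $\widehat{C}'$.
\<close>

definition C_eucl :: "complex set \<Rightarrow> ennreal" where
  "C_eucl \<Omega> = (INF z\<in>\<Omega>. eucl_bdist \<Omega> z * ennreal (hyp_density \<Omega> z))"

definition C_tilde :: "complex set \<Rightarrow> ennreal" where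
  "C_tilde \<Omega> = (INF z\<in>\<Omega>. chordal_bdist \<Omega> z * ennreal (spherical_density \<Omega> z))"

definition C_hat :: "complex set \<Rightarrow> ennreal" where
  "C_hat \<Omega> = (INF z\<in>\<Omega>. tau_bdist \<Omega> z * ennreal (spherical_density \<Omega> z))"

definition C_tilde' :: "complex set \<Rightarrow> ennreal" where
  "C_tilde' \<Omega> = C_tilde \<Omega> / chordal_diameter (sphere_complement \<Omega>)"

definition C_hat' :: "complex set \<Rightarrow> ennreal" where
  "C_hat' \<Omega> = C_hat \<Omega> / chordal_diameter (sphere_complement \<Omega>)"

end

theory Submission
  imports Defs
begin

text \<open>
  Part (i) compares \<open>\<Omega>\<close> near a frontier point with the disc inside \<open>\<Omega>\<close> that touches the frontier
  there; the Schwarz--Pick lemma, applied to lifts through a covering, makes the density monotone.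
  The other parts are pointwise inequalities between the distances alone. For (iii), either the
  nearest frontier point \<open>a\<close> of \<open>z\<close> satisfies \<open>2 |1 + z cnj a| \<ge> 1 + |z|\<^sup>2\<close>, or the point at infinity
  is \<open>\<tau>\<close>-close enough to \<open>z\<close>; for bounded \<open>\<Omega>\<close> it is replaced by a frontier point on the ray from \<open>z\<close>
  away from \<open>0\<close>, which is no farther. For (iv), put \<open>W = sqrt (1 + |w|\<^sup>2)\<close> and let \<open>d\<close> be the Euclidean
  distance of \<open>w\<close> to the frontier. Then \<open>W\<^sup>2 \<delta>(w) \<ge> W d / (W + d)\<close>, while the chordal diameter of the
  complement is at most \<open>4 W / (W + d)\<close>: this is trivial for \<open>d \<le> 3 W\<close>, and for larger \<open>d\<close> the
  complement lies close to infinity.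
\<close>

section \<open>The Schwarz--Pick lemma\<close>

lemma Moebius_function_has_field_derivative:
  assumes "1 - cnj w * z \<noteq> 0"
  shows "(Moebius_function 0 w has_field_derivative (1 - cnj w * w) / (1 - cnj w * z)\<^sup>2) (at z)"
  unfolding Moebius_function_def
  using assms
  by (auto intro!: derivative_eq_intros simp: field_simps power2_eq_square)

text \<open>Composing \<open>g\<close> with the disc automorphism taking 0 to \<open>z\<close> and
  then with the one taking \<open>g z\<close> to 0 gives a self-map \<open>h\<close> of the disc
  fixing 0. The Schwarz lemma bounds \<open>deriv h 0\<close>, and the chain rule turns that bound
  into the claim.\<close>

lemma Schwarz_Pick:
  assumes holg: "g holomorphic_on ball 0 1" and g: "g \<in> ball 0 1 \<rightarrow> ball 0 1" and z: "cmod z < 1"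
  shows "cmod (deriv g z) * (1 - (cmod z)\<^sup>2) \<le> 1 - (cmod (g z))\<^sup>2"
proof -
  define b where "b = g z"
  have b: "cmod b < 1"
    using g z by (auto simp: b_def)
  define M where "M = Moebius_function 0"
  define h where "h = M b \<circ> (g \<circ> M (- z))"
  have pos: "0 < 1 - (cmod z)\<^sup>2" "0 < 1 - (cmod b)\<^sup>2"
    using z b by (auto simp: abs_square_less_1)
  have cnj: "1 - cnj u * u = of_real (1 - (cmod u)\<^sup>2)" for u
    using complex_norm_square[of u] by (simp add: mult.commute)
  have M1: "M (- z) ` ball 0 1 \<subseteq> ball 0 1" "M b ` ball 0 1 \<subseteq> ball 0 1"
    using Moebius_function_norm_lt_1 z b by (auto simp: M_def)
  have M0: "M (- z) 0 = z"
    by (simp add: M_def Moebius_function_of_zero)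
  have Mhol: "M u holomorphic_on ball 0 1" if "cmod u < 1" for u
    unfolding M_def using that by (rule Moebius_function_holomorphic)
  have "(g \<circ> M (- z)) holomorphic_on ball 0 1"
    using M1 z by (intro holomorphic_on_compose_gen[OF Mhol holg]) auto
  then have "h holomorphic_on ball 0 1"
    unfolding h_def
  proof (rule holomorphic_on_compose_gen[OF _ Mhol[OF b]])
    show "(g \<circ> M (- z)) ` ball 0 1 \<subseteq> ball 0 1"
      using M1(1) g by (auto simp: image_subset_iff Pi_iff simp del: mem_ball)
  qed
  moreover have "h 0 = 0"
    using M0 by (simp add: h_def b_def M_def Moebius_function_eq_zero)
  moreover have "cmod (h x) < 1" if "cmod x < 1" for x
  proof -
    have "x \<in> ball 0 1"
      using that by simp
    then have "h x \<in> ball 0 1"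
      using M1 g by (auto simp: h_def image_subset_iff Pi_iff simp del: mem_ball)
    then show ?thesis
      by simp
  qed
  ultimately have le1: "cmod (deriv h 0) \<le> 1"
    using Schwarz_Lemma(2)[of h 0] by auto
  have "(g has_field_derivative deriv g z) (at (M (- z) 0))"
    using holomorphic_derivI[OF holg open_ball, of z] z M0 by simp
  moreover have "(M (- z) has_field_derivative 1 - cnj z * z) (at 0)"
    using Moebius_function_has_field_derivative[of "- z" 0] by (simp add: M_def)
  ultimately have d1: "(g \<circ> M (- z) has_field_derivative deriv g z * (1 - cnj z * z)) (at 0)"
    by (rule DERIV_chain)
  have "1 - cnj b * b \<noteq> 0"
    unfolding cnj of_real_eq_0_iff using pos by simp
  then have "(M b has_field_derivative 1 / (1 - cnj b * b)) (at ((g \<circ> M (- z)) 0))"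
    using Moebius_function_has_field_derivative[of b b] M0
    by (simp add: b_def[symmetric] power2_eq_square M_def)
  from DERIV_chain[OF this d1]
  have "deriv h 0 = 1 / (1 - cnj b * b) * (deriv g z * (1 - cnj z * z))"
    unfolding h_def by (rule DERIV_imp_deriv)
  moreover have "cmod (1 - cnj b * b) = 1 - (cmod b)\<^sup>2" "cmod (1 - cnj z * z) = 1 - (cmod z)\<^sup>2"
    using pos by (simp_all only: cnj norm_of_real abs_of_pos)
  ultimately have "cmod (deriv h 0) = cmod (deriv g z) * (1 - (cmod z)\<^sup>2) / (1 - (cmod b)\<^sup>2)"
    by (simp only: norm_mult norm_divide) simp
  with le1 pos show ?thesis
    by (simp add: divide_le_eq b_def)
qed


section \<open>The density of the hyperbolic metric\<close>

text \<open>A covering map is locally injective, and an injective holomorphic function has no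
  critical points. This permits division by \<open>deriv p z\<close> in the formula for the
  density.\<close>

lemma universal_covering_deriv_nonzero:
  assumes "universal_covering p \<Omega>" "z \<in> ball 0 1"
  shows "deriv p z \<noteq> 0"
proof -
  have holp: "p holomorphic_on ball 0 1" and cov: "covering_space (ball 0 1) p \<Omega>"
    using assms(1) by (auto simp: universal_covering_def)
  obtain T u q where T: "z \<in> T" "openin (top_of_set (ball 0 1)) T" "homeomorphism T u p q"
    using covering_space_local_homeomorphism[OF cov assms(2)] .
  have "open T"
    using openin_open_trans[OF T(2) open_ball] .
  moreover have "p holomorphic_on T"
    using holp openin_imp_subset[OF T(2)] by (rule holomorphic_on_subset)
  moreover have "inj_on p T"
    using homeomorphism_apply1[OF T(3)] by (rule inj_on_inverseI)
  ultimately show ?thesis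
    using T(1) by (intro holomorphic_injective_imp_regular[of p T])
qed

text \<open>The disc is simply connected, so \<open>f\<close> lifts through \<open>p\<close> to a
  holomorphic self-map \<open>g\<close> of the disc with \<open>g z = a\<close>. The chain rule for
  \<open>f = p o g\<close> and Schwarz--Pick for \<open>g\<close> give the bound, whose right side
  is the reciprocal of the density at \<open>p a\<close>.\<close>

lemma universal_covering_deriv_bound:
  assumes p: "universal_covering p \<Omega>" and holf: "f holomorphic_on ball 0 1"
    and f: "f \<in> ball 0 1 \<rightarrow> \<Omega>" and z: "z \<in> ball 0 1" and a: "a \<in> ball 0 1" "p a = f z"
  shows "cmod (deriv f z) * (1 - (cmod z)\<^sup>2) \<le> cmod (deriv p a) * (1 - (cmod a)\<^sup>2)"
proof -
  have holp: "p holomorphic_on ball 0 1" and cov: "covering_space (ball 0 1) p \<Omega>"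
    using p by (auto simp: universal_covering_def)
  obtain g where g: "continuous_on (ball 0 1) g" "g \<in> ball 0 1 \<rightarrow> ball 0 1" "g z = a"
      "\<And>y. y \<in> ball 0 1 \<Longrightarrow> p (g y) = f y"
  proof (rule covering_space_lift_strong[OF cov a(1) z])
    show "simply_connected (ball (0::complex) 1)" "locally path_connected (ball (0::complex) 1)"
      by (intro convex_imp_simply_connected convex_imp_locally_path_connected convex_ball)+
    show "continuous_on (ball 0 1) f"
      by (rule holomorphic_on_imp_continuous_on[OF holf])
  qed (use f a(2) in auto)
  have holg: "g holomorphic_on ball 0 1"
    using covering_space_lift_is_holomorphic[OF cov open_ball holp holf f g(2,1)] g(4) by blast
  have "(p has_field_derivative deriv p a) (at (g z))"
    using holomorphic_derivI[OF holp open_ball a(1)] g(3) by simp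
  moreover have "(g has_field_derivative deriv g z) (at z)"
    using holomorphic_derivI[OF holg open_ball z] .
  ultimately have "(p \<circ> g has_field_derivative deriv p a * deriv g z) (at z)"
    by (rule DERIV_chain)
  then have "(f has_field_derivative deriv p a * deriv g z) (at z)"
    by (rule has_field_derivative_transform_within_open[OF _ open_ball z]) (use g(4) in auto)
  then have "deriv f z = deriv p a * deriv g z"
    by (rule DERIV_imp_deriv)
  then have "cmod (deriv f z) * (1 - (cmod z)\<^sup>2) =
      cmod (deriv p a) * (cmod (deriv g z) * (1 - (cmod z)\<^sup>2))"
    by (simp add: norm_mult)
  also have "\<dots> \<le> cmod (deriv p a) * (1 - (cmod a)\<^sup>2)"
    using Schwarz_Pick[OF holg g(2)] z g(3) by (intro mult_left_mono) auto
  finally show ?thesis .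
qed

text \<open>This is the well-definedness of the density. Given two coverings with points over the
  same \<open>w\<close>, each maps the disc into \<Omega> and can be lifted through the other, so
  \<open>universal_covering_deriv_bound\<close> applies in both directions and the candidate values
  agree.\<close>

lemma hyp_density_universal_covering:
  assumes p: "universal_covering p \<Omega>" and z: "z \<in> ball 0 1"
  shows "hyp_density \<Omega> (p z) = 1 / ((1 - (cmod z)\<^sup>2) * cmod (deriv p z))"
proof -
  have eq: "cmod (deriv q y) * (1 - (cmod y)\<^sup>2) = cmod (deriv p z) * (1 - (cmod z)\<^sup>2)"
    if q: "universal_covering q \<Omega>" and y: "y \<in> ball 0 1" "q y = p z" for q y
  proof (rule antisym)
    have maps: "f holomorphic_on ball 0 1 \<and> f \<in> ball 0 1 \<rightarrow> \<Omega>" if "universal_covering f \<Omega>" for f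
      using that covering_space_imp_surjective by (fastforce simp: universal_covering_def)
    show "cmod (deriv q y) * (1 - (cmod y)\<^sup>2) \<le> cmod (deriv p z) * (1 - (cmod z)\<^sup>2)"
      using universal_covering_deriv_bound[OF p _ _ y(1) z] maps[OF q] y(2) by simp
    show "cmod (deriv p z) * (1 - (cmod z)\<^sup>2) \<le> cmod (deriv q y) * (1 - (cmod y)\<^sup>2)"
      using universal_covering_deriv_bound[OF q _ _ z y(1)] maps[OF p] y(2) by simp
  qed
  have pos: "0 < 1 - (cmod y)\<^sup>2" if "y \<in> ball 0 1" for y :: complex
    using that by (simp add: abs_square_less_1)
  have nz: "cmod (deriv q y) \<noteq> 0" if "universal_covering q \<Omega>" "y \<in> ball 0 1" for q y
    using universal_covering_deriv_nonzero[OF that] by simp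
  let ?l = "1 / ((1 - (cmod z)\<^sup>2) * cmod (deriv p z))"
  have "(THE l. \<forall>q y. universal_covering q \<Omega> \<and> y \<in> ball 0 1 \<and> q y = p z \<longrightarrow>
            1 / (1 - (cmod y)\<^sup>2) = l * cmod (deriv q y)) = ?l"
  proof (rule the_equality)
    show "\<forall>q y. universal_covering q \<Omega> \<and> y \<in> ball 0 1 \<and> q y = p z \<longrightarrow>
            1 / (1 - (cmod y)\<^sup>2) = ?l * cmod (deriv q y)"
    proof (intro allI impI)
      fix q y
      assume qy: "universal_covering q \<Omega> \<and> y \<in> ball 0 1 \<and> q y = p z"
      then have "cmod (deriv q y) * (1 - (cmod y)\<^sup>2) = cmod (deriv p z) * (1 - (cmod z)\<^sup>2)"
        using eq by blast
      moreover have "0 < 1 - (cmod y)\<^sup>2" "0 < 1 - (cmod z)\<^sup>2" "cmod (deriv p z) \<noteq> 0"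
        using qy pos z nz p by blast+
      ultimately show "1 / (1 - (cmod y)\<^sup>2) = ?l * cmod (deriv q y)"
        by (simp add: frac_eq_eq mult.commute)
    qed
    fix l
    assume "\<forall>q y. universal_covering q \<Omega> \<and> y \<in> ball 0 1 \<and> q y = p z \<longrightarrow>
            1 / (1 - (cmod y)\<^sup>2) = l * cmod (deriv q y)"
    then have "1 / (1 - (cmod z)\<^sup>2) = l * cmod (deriv p z)"
      using p z by blast
    then show "l = ?l"
      using pos[OF z] nz[OF p z] by (simp add: field_simps)
  qed
  then show ?thesis
    using p z by (auto simp: hyp_density_def)
qed

text \<open>
  Without a covering, \<^const>\<open>hyp_density\<close> is the junk value \<open>0\<close>, and all bounds below hold trivially;
  hence the uniformization theorem is never needed.
\<close>

lemma hyp_density_nonneg: "0 \<le> hyp_density \<Omega> w"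
proof (cases "\<exists>p z. universal_covering p \<Omega> \<and> z \<in> ball 0 1 \<and> p z = w")
  case True
  then obtain p z where p: "universal_covering p \<Omega>" and z: "z \<in> ball 0 1" and w: "p z = w"
    by blast
  have "0 \<le> 1 - (cmod z)\<^sup>2"
    using z by (simp add: abs_square_le_1)
  then show ?thesis
    using hyp_density_universal_covering[OF p z] w by simp
next
  case False
  then show ?thesis
    by (simp only: hyp_density_def if_False order_refl)
qed

text \<open>Schwarz--Pick for maps of the disc into \<Omega>: pulling the hyperbolic metric back by
  \<open>f\<close> does not exceed the metric of the disc. It is
  \<open>universal_covering_deriv_bound\<close> with reciprocals taken.\<close>

lemma hyp_density_contracting:
  assumes holf: "f holomorphic_on ball 0 1" and f: "f \<in> ball 0 1 \<rightarrow> \<Omega>" and z: "z \<in> ball 0 1"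
  shows "hyp_density \<Omega> (f z) * cmod (deriv f z) \<le> 1 / (1 - (cmod z)\<^sup>2)"
proof (cases "\<exists>p a. universal_covering p \<Omega> \<and> a \<in> ball 0 1 \<and> p a = f z")
  case True
  then obtain p a where p: "universal_covering p \<Omega>" and a: "a \<in> ball 0 1" "p a = f z"
    by blast
  have pos: "0 < 1 - (cmod z)\<^sup>2" "0 < 1 - (cmod a)\<^sup>2" "0 < cmod (deriv p a)"
    using a z universal_covering_deriv_nonzero[OF p a(1)] by (auto simp: abs_square_less_1)
  have "hyp_density \<Omega> (f z) = 1 / ((1 - (cmod a)\<^sup>2) * cmod (deriv p a))"
    using hyp_density_universal_covering[OF p a(1)] a(2) by simp
  moreover have "cmod (deriv f z) / ((1 - (cmod a)\<^sup>2) * cmod (deriv p a)) \<le> 1 / (1 - (cmod z)\<^sup>2)"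
    using universal_covering_deriv_bound[OF p holf f z a] pos
    by (intro divide_le_eq[THEN iffD2]) (auto simp: pos_le_divide_eq mult_ac)
  ultimately show ?thesis
    by simp
next
  case False
  have "0 \<le> 1 - (cmod z)\<^sup>2"
    using z by (simp add: abs_square_le_1)
  moreover have "hyp_density \<Omega> (f z) = 0"
    by (simp only: hyp_density_def False if_False)
  ultimately show ?thesis
    by simp
qed

text \<open>The right side is the density of \<open>ball c r\<close> itself, so this is monotonicity
  of the density for a disc inside \<Omega>. It comes from the contraction property of the affine
  map of the unit disc onto that ball.\<close>

lemma hyp_density_le_ball:
  assumes "ball c r \<subseteq> \<Omega>" "w \<in> ball c r"
  shows "hyp_density \<Omega> w \<le> r / (r\<^sup>2 - (dist c w)\<^sup>2)"
proof -
  have r: "0 < r"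
    using assms(2) by (metis mem_ball order_le_less_trans zero_le_dist)
  define f where "f = (\<lambda>\<zeta>. c + of_real r * \<zeta>)"
  define z where "z = (w - c) / of_real r"
  have nz: "cmod z = dist c w / r"
    using r by (simp add: z_def norm_divide dist_norm norm_minus_commute)
  have "f z = w"
    using r by (simp add: f_def z_def)
  have z: "z \<in> ball 0 1"
    using assms(2) r nz by simp
  have "deriv f z = of_real r"
    unfolding f_def by (rule DERIV_imp_deriv) (auto intro!: derivative_eq_intros)
  moreover have "f \<in> ball 0 1 \<rightarrow> \<Omega>"
    using assms(1) r by (auto simp: f_def dist_norm norm_mult)
  moreover have "f holomorphic_on ball 0 1"
    unfolding f_def by (intro holomorphic_intros)
  ultimately have "hyp_density \<Omega> w * r \<le> 1 / (1 - (dist c w / r)\<^sup>2)"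
    using hyp_density_contracting[of f \<Omega> z] z r \<open>f z = w\<close> nz by simp
  also have "1 / (1 - (dist c w / r)\<^sup>2) = r * (r / (r\<^sup>2 - (dist c w)\<^sup>2))"
    using r by (simp add: field_simps power2_eq_square)
  finally have "r * hyp_density \<Omega> w \<le> r * (r / (r\<^sup>2 - (dist c w)\<^sup>2))"
    by (simp only: mult.commute)
  then show ?thesis
    using mult_le_cancel_left_pos[OF r] by blast
qed


section \<open>The boundary of a plane domain in the sphere\<close>

text \<open>\<open>Some\<close> embeds the plane as an open subset of the sphere. Images of open
  sets give one inclusion of closures, preimages the other.\<close>

lemma Some_in_sphere_boundary_iff:
  assumes "open \<Omega>"
  shows "Some a \<in> sphere_boundary \<Omega> \<longleftrightarrow> a \<in> frontier \<Omega>"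
proof -
  have "sphere_topology interior_of Some ` \<Omega> = Some ` \<Omega>"
    using assms by (intro interior_of_openin) simp
  moreover have "Some a \<in> sphere_topology closure_of Some ` \<Omega> \<longleftrightarrow> a \<in> closure \<Omega>"
  proof
    assume L: "Some a \<in> sphere_topology closure_of Some ` \<Omega>"
    show "a \<in> closure \<Omega>"
      unfolding closure_iff_nhds_not_empty
    proof (intro allI impI)
      fix A S
      assume "S \<subseteq> A" "open S" "a \<in> S"
      then have "\<exists>y. y \<in> Some ` \<Omega> \<and> y \<in> Some ` S"
        using L openin_Alexandroff_compactification_image_Some[of euclidean S]
        unfolding in_closure_of by (metis image_eqI open_openin)
      then show "\<Omega> \<inter> A \<noteq> {}"
        using \<open>S \<subseteq> A\<close> by auto
    qed
  next
    assume R: "a \<in> closure \<Omega>"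
    have "\<exists>y\<in>Some ` \<Omega>. y \<in> T" if T: "Some a \<in> T" "openin sphere_topology T" for T
    proof -
      define U where "U = {x. Some x \<in> T}"
      have U: "open U" "a \<in> U"
        using openin_continuous_map_preimage[OF continuous_map_Some T(2)] T(1)
        by (simp_all add: U_def)
      then have "\<Omega> \<inter> U \<noteq> {}"
        using R by (meson closure_iff_nhds_not_empty order_refl)
      then show ?thesis
        by (auto simp: U_def)
    qed
    then show "Some a \<in> sphere_topology closure_of Some ` \<Omega>"
      unfolding in_closure_of by auto
  qed
  ultimately show ?thesis
    using assms by (auto simp: sphere_boundary_def frontier_of_def frontier_def interior_open)
qed

text \<open>Neighbourhoods of infinity are complements of compact sets, and an unbounded set meets
  each of them.\<close>

lemma None_in_sphere_boundary:
  assumes "open \<Omega>" "\<not> bounded \<Omega>"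
  shows "None \<in> sphere_boundary \<Omega>"
proof -
  have "sphere_topology interior_of Some ` \<Omega> = Some ` \<Omega>"
    using assms by (intro interior_of_openin) simp
  moreover have "\<exists>y. y \<in> Some ` \<Omega> \<and> y \<in> T" if T: "None \<in> T" "openin sphere_topology T" for T
  proof -
    obtain C where C: "compact C" "T = insert None (Some ` (UNIV - C))"
      using T by (auto simp: openin_Alexandroff_compactification)
    then have "\<not> \<Omega> \<subseteq> C"
      using assms(2) bounded_subset compact_imp_bounded by blast
    then show ?thesis
      using C(2) by auto
  qed
  ultimately show ?thesis
    by (auto simp: sphere_boundary_def frontier_of_def in_closure_of)
qed

text \<open>Of two distinct boundary points at most one is infinity, so the frontier in the plane is
  nonempty.\<close>

lemma hyperbolic_domainD:
  assumes "hyperbolic_domain \<Omega>"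
  shows "open \<Omega>" "\<Omega> \<noteq> {}" "frontier \<Omega> \<noteq> {}"
proof -
  show op: "open \<Omega>" and "\<Omega> \<noteq> {}"
    using assms by (auto simp: hyperbolic_domain_def)
  obtain a b where "a \<noteq> b" "a \<in> sphere_boundary \<Omega>" "b \<in> sphere_boundary \<Omega>"
    using assms by (auto simp: hyperbolic_domain_def)
  then obtain c where "Some c \<in> sphere_boundary \<Omega>"
    by (cases a; cases b) auto
  then show "frontier \<Omega> \<noteq> {}"
    using Some_in_sphere_boundary_iff[OF op] by auto
qed

lemma ball_infdist_frontier_subset:
  fixes \<Omega> :: "'a::real_normed_vector set"
  assumes "w \<in> \<Omega>"
  shows "ball w (infdist w (frontier \<Omega>)) \<subseteq> \<Omega>"
proof (rule ccontr)
  assume "\<not> ball w (infdist w (frontier \<Omega>)) \<subseteq> \<Omega>"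
  then obtain x where x: "dist w x < infdist w (frontier \<Omega>)" "x \<notin> \<Omega>"
    by (meson mem_ball subsetI)
  \<comment> \<open>This closed ball is connected and contains \<open>w\<close> inside \<Omega> and
    \<open>x\<close> outside it.\<close>
  have "cball w (dist w x) \<inter> frontier \<Omega> \<noteq> {}"
  proof (rule connected_Int_frontier)
    show "cball w (dist w x) \<inter> \<Omega> \<noteq> {}"
      by (metis assms IntI centre_in_cball empty_iff zero_le_dist)
    show "cball w (dist w x) - \<Omega> \<noteq> {}"
      using x(2) by (metis DiffI dist_commute empty_iff mem_cball order_refl)
  qed (intro convex_connected convex_cball)
  then obtain y where "y \<in> frontier \<Omega>" "dist w y \<le> dist w x"
    by auto
  then show False
    using x(1) infdist_le[of y "frontier \<Omega>" w] by linarith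
qed

text \<open>Infinity contributes the value \<open>\<infinity>\<close> and never lowers the infimum,
  so the real-valued \<open>infdist\<close> can be used in the estimates.\<close>

lemma eucl_bdist_eq_infdist:
  assumes "open \<Omega>" "frontier \<Omega> \<noteq> {}"
  shows "eucl_bdist \<Omega> z = ennreal (infdist z (frontier \<Omega>))"
proof (rule antisym)
  obtain a where "a \<in> frontier \<Omega>" "infdist z (frontier \<Omega>) = dist z a"
    using infdist_attains_inf[OF frontier_closed assms(2)] .
  then show "eucl_bdist \<Omega> z \<le> ennreal (infdist z (frontier \<Omega>))"
    unfolding eucl_bdist_def
    by (intro INF_lower2[of "Some a"]) (auto simp: Some_in_sphere_boundary_iff assms dist_norm)
  show "ennreal (infdist z (frontier \<Omega>)) \<le> eucl_bdist \<Omega> z"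
    unfolding eucl_bdist_def
  proof (rule INF_greatest)
    fix b
    assume b: "b \<in> sphere_boundary \<Omega>"
    show "ennreal (infdist z (frontier \<Omega>)) \<le> eucl_dist z b"
    proof (cases b)
      case (Some c)
      then show ?thesis
        using b infdist_le[of c "frontier \<Omega>" z]
        by (auto simp: Some_in_sphere_boundary_iff assms dist_norm intro!: ennreal_leI)
    qed simp
  qed
qed


section \<open>Comparison of the distances\<close>

lemma one_plus_cmod_square_pos [simp]: "0 < 1 + (cmod z)\<^sup>2"
  by (simp add: add_pos_nonneg)

text \<open>This identity expresses that \<tau> equals \<sigma> / sqrt (1 - \<sigma>^2). It bounds
  both the numerator and the denominator of \<tau> by the denominator of \<sigma>.\<close>

lemma cmod_one_plus_mult_cnj:
  "(cmod (1 + z * cnj w))\<^sup>2 + (cmod (z - w))\<^sup>2 = (1 + (cmod z)\<^sup>2) * (1 + (cmod w)\<^sup>2)"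
  unfolding cmod_power2 by (simp add: algebra_simps power2_eq_square)

lemma chordal_dist_le_tau_dist: "ennreal (chordal_dist (Some z) a) \<le> tau_dist (Some z) a"
proof (cases a)
  case None
  show ?thesis
  proof (cases "z = 0")
    case False
    then have "1 / sqrt (1 + (cmod z)\<^sup>2) \<le> 1 / cmod z"
      by (intro divide_left_mono real_le_rsqrt mult_pos_pos) auto
    then show ?thesis
      using None False by (simp add: divide_ennreal ennreal_leI flip: ennreal_1)
  qed (use None in \<open>simp add: ennreal_divide_zero\<close>)
next
  case (Some w)
  show ?thesis
  proof (cases "1 + z * cnj w = 0")
    case True
    \<comment> \<open>In \<open>ennreal\<close> the quotient 0 / 0 is 0, so a positive numerator is
      required for \<tau> to be infinite at antipodal points.\<close>
    have "z \<noteq> w"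
    proof
      assume "z = w"
      then have "1 + (cmod z)\<^sup>2 = 0"
        using True by (metis complex_norm_square of_real_1 of_real_add of_real_eq_0_iff)
      then show False
        by (smt (verit) zero_le_power2)
    qed
    then show ?thesis
      using True Some by (simp add: ennreal_divide_zero)
  next
    case False
    have "cmod (1 + z * cnj w) \<le> sqrt ((1 + (cmod z)\<^sup>2) * (1 + (cmod w)\<^sup>2))"
      by (rule real_le_rsqrt) (simp flip: cmod_one_plus_mult_cnj)
    then have "chordal_dist (Some z) a \<le> cmod (z - w) / cmod (1 + z * cnj w)"
      using False Some by (auto intro!: divide_left_mono mult_pos_pos add_pos_nonneg)
    then show ?thesis
      using False Some by (simp add: divide_ennreal ennreal_leI)
  qed
qed

lemma chordal_bdist_le_tau_bdist: "chordal_bdist \<Omega> z \<le> tau_bdist \<Omega> z"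
  unfolding chordal_bdist_def tau_bdist_def by (intro INF_mono' chordal_dist_le_tau_dist)

lemma chordal_dist_le_1: "chordal_dist x y \<le> 1"
proof (cases x; cases y)
  fix z w
  assume "x = Some z" "y = Some w"
  moreover have "cmod (z - w) \<le> sqrt ((1 + (cmod z)\<^sup>2) * (1 + (cmod w)\<^sup>2))"
    by (rule real_le_rsqrt) (simp flip: cmod_one_plus_mult_cnj)
  moreover have "0 < sqrt ((1 + (cmod z)\<^sup>2) * (1 + (cmod w)\<^sup>2))"
    by (intro real_sqrt_gt_zero mult_pos_pos one_plus_cmod_square_pos)
  ultimately show ?thesis
    by (simp only: chordal_dist.simps pos_divide_le_eq mult_1)
qed (auto simp: divide_le_eq_1)

lemma chordal_dist_le_via_infinity:
  "chordal_dist x y \<le> chordal_dist x None + chordal_dist None y"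
proof (cases x; cases y)
  fix z w
  assume xy: "x = Some z" "y = Some w"
  define Z W where "Z = sqrt (1 + (cmod z)\<^sup>2)" and "W = sqrt (1 + (cmod w)\<^sup>2)"
  have "cmod z \<le> Z" "cmod w \<le> W" "0 < Z" "0 < W"
    unfolding Z_def W_def by (auto intro: real_le_rsqrt add_pos_nonneg)
  moreover have "cmod (z - w) \<le> cmod z + cmod w"
    by (rule norm_triangle_ineq4)
  ultimately have "cmod (z - w) / (Z * W) \<le> (Z + W) / (Z * W)"
    by (intro divide_right_mono) auto
  also have "\<dots> = 1 / Z + 1 / W"
    using \<open>0 < Z\<close> \<open>0 < W\<close> by (simp add: field_simps)
  finally show ?thesis
    using xy by (simp add: Z_def W_def real_sqrt_mult)
qed auto

text \<open>The bound is the \<tau>-distance from \<open>z\<close> to infinity. For bounded \<Omega>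
  the outward ray from \<open>z\<close> meets the frontier at some \<open>t * z\<close> with
  \<open>t \<ge> 1\<close>, which serves instead.\<close>

lemma tau_bdist_le_inverse_cmod:
  assumes "open \<Omega>" "z \<in> \<Omega>" "z \<noteq> 0"
  shows "tau_bdist \<Omega> z \<le> ennreal (1 / cmod z)"
proof (cases "bounded \<Omega>")
  case False
  then show ?thesis
    unfolding tau_bdist_def using assms None_in_sphere_boundary
    by (intro INF_lower2[of None]) (auto simp: divide_ennreal simp flip: ennreal_1)
next
  case True
  define R where "R = (\<lambda>t. of_real t * z) ` {1..}"
  have "\<not> bounded R"
  proof
    assume "bounded R"
    then obtain B where B: "\<And>x. x \<in> R \<Longrightarrow> cmod x \<le> B"
      by (auto simp: bounded_iff)
    define t where "t = max 1 ((B + 1) / cmod z)"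
    have "(B + 1) / cmod z * cmod z \<le> t * cmod z"
      by (intro mult_right_mono) (auto simp: t_def)
    then have "B + 1 \<le> cmod (of_real t * z)"
      using assms(3) by (simp add: norm_mult t_def)
    moreover have "of_real t * z \<in> R"
      by (auto simp: R_def t_def)
    ultimately show False
      using B by force
  qed
  then have "R - \<Omega> \<noteq> {}"
    using True bounded_subset by blast
  moreover have "z \<in> R"
    unfolding R_def by (rule image_eqI[of _ _ 1]) auto
  moreover have "connected R"
    unfolding R_def by (intro connected_continuous_image continuous_intros) simp
  ultimately have "R \<inter> frontier \<Omega> \<noteq> {}"
    using assms(2) by (intro connected_Int_frontier) auto
  then obtain t where t: "1 \<le> t" "of_real t * z \<in> frontier \<Omega>"
    by (auto simp: R_def)
  have pos: "0 < 1 + t * (cmod z)\<^sup>2"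
    using t(1) by (intro add_pos_nonneg) auto
  have "1 + z * cnj (of_real t * z) = of_real (1 + t * (cmod z)\<^sup>2)"
    using complex_norm_square[of z] by (simp add: mult_ac)
  then have den: "cmod (1 + z * cnj (of_real t * z)) = 1 + t * (cmod z)\<^sup>2"
    using pos by (metis abs_of_pos norm_of_real)
  have "z - of_real t * z = of_real (1 - t) * z"
    by (simp add: algebra_simps)
  then have num: "cmod (z - of_real t * z) = (t - 1) * cmod z"
    using t(1) by (simp add: norm_mult del: of_real_diff)
  \<comment> \<open>After clearing denominators this reads (t - 1) |z|^2 \<le> 1 + t |z|^2.\<close>
  have "(t - 1) * cmod z / (1 + t * (cmod z)\<^sup>2) \<le> 1 / cmod z"
    using pos assms(3) by (simp add: divide_simps) (simp add: algebra_simps power2_eq_square)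
  moreover have "tau_dist (Some z) (Some (of_real t * z)) =
      ennreal ((t - 1) * cmod z / (1 + t * (cmod z)\<^sup>2))"
    unfolding tau_dist.simps den num using pos t(1) by (intro divide_ennreal) auto
  ultimately show ?thesis
    unfolding tau_bdist_def using t(2) assms(1)
    by (intro INF_lower2[of "Some (of_real t * z)"])
       (auto simp: Some_in_sphere_boundary_iff simp del: tau_dist.simps intro!: ennreal_leI)
qed

lemma tau_bdist_le_infdist:
  assumes "open \<Omega>" "z \<in> \<Omega>" "frontier \<Omega> \<noteq> {}"
  shows "tau_bdist \<Omega> z * ennreal (1 + (cmod z)\<^sup>2) \<le> 2 * ennreal (infdist z (frontier \<Omega>))"
proof -
  obtain a where a: "a \<in> frontier \<Omega>" "infdist z (frontier \<Omega>) = dist z a"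
    using infdist_attains_inf[OF frontier_closed assms(3)] .
  define d where "d = cmod (z - a)"
  define x where "x = (1 + (cmod z)\<^sup>2)"
  have "0 < x"
    unfolding x_def by (intro add_pos_nonneg) auto
  \<comment> \<open>A real majorant \<open>t\<close> keeps the arithmetic of both cases out of
    \<open>ennreal\<close>. The case split asks whether replacing \<open>z\<close> by
    \<open>a\<close> in 1 + |z|^2 can lose more than half of it.\<close>
  have "\<exists>t. tau_bdist \<Omega> z \<le> ennreal t \<and> 0 \<le> t \<and> t * x \<le> 2 * d"
  proof (cases "2 * (cmod z * d) \<le> x")
    case True
    have "1 + z * cnj a = of_real x - z * cnj (z - a)"
      unfolding x_def using complex_norm_square[of z] by (simp add: algebra_simps)
    then have "x - cmod z * d \<le> cmod (1 + z * cnj a)"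
      using norm_triangle_ineq2[of "of_real x" "z * cnj (z - a)"] \<open>0 < x\<close>
      by (simp add: norm_mult d_def del: complex_cnj_diff)
    then have den: "x / 2 \<le> cmod (1 + z * cnj a)"
      using True by linarith
    have "tau_bdist \<Omega> z \<le> tau_dist (Some z) (Some a)"
      unfolding tau_bdist_def using a(1) assms(1)
      by (intro INF_lower) (simp add: Some_in_sphere_boundary_iff)
    also have "\<dots> = ennreal (d / cmod (1 + z * cnj a))"
      unfolding tau_dist.simps d_def using den \<open>0 < x\<close> by (intro divide_ennreal) auto
    finally have "tau_bdist \<Omega> z \<le> ennreal (d / cmod (1 + z * cnj a))" .
    moreover have "d / cmod (1 + z * cnj a) * x \<le> 2 * d"
    proof -
      have "d * x \<le> d * (2 * cmod (1 + z * cnj a))"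
        using den by (intro mult_left_mono) (auto simp: d_def)
      moreover have "0 < cmod (1 + z * cnj a)"
        using den \<open>0 < x\<close> by linarith
      ultimately show ?thesis
        by (simp add: divide_le_eq mult_ac)
    qed
    ultimately show ?thesis
      by (intro exI[of _ "d / cmod (1 + z * cnj a)"]) (auto simp: d_def)
  next
    case False
    \<comment> \<open>Here x / |z| < 2 d, so the \<tau>-distance 1 / |z| to infinity is already
      small enough.\<close>
    then have "z \<noteq> 0"
      using \<open>0 < x\<close> by auto
    moreover from this False have "1 / cmod z * x \<le> 2 * d"
      by (simp add: divide_le_eq mult_ac)
    ultimately show ?thesis
      using tau_bdist_le_inverse_cmod[OF assms(1,2)] by (intro exI[of _ "1 / cmod z"]) auto
  qed
  then obtain t where t: "tau_bdist \<Omega> z \<le> ennreal t" "0 \<le> t" "t * x \<le> 2 * d"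
    by blast
  have "tau_bdist \<Omega> z * ennreal x \<le> ennreal t * ennreal x"
    by (intro mult_right_mono t) simp
  also have "\<dots> = ennreal (t * x)"
    using t \<open>0 < x\<close> by (simp add: ennreal_mult)
  also have "\<dots> \<le> ennreal (2 * d)"
    by (intro ennreal_leI t)
  also have "\<dots> = 2 * ennreal d"
    by (simp add: ennreal_mult d_def)
  finally show ?thesis
    by (simp add: x_def a(2) d_def dist_norm)
qed

text \<open>For a frontier point \<open>c\<close> at distance \<open>x \<ge> d\<close>, the
  denominator of \<sigma> is at most W (W + x), and x / (W + x) increases with \<open>x\<close>. The
  point at infinity has distance 1 / W, which is larger than the bound.\<close>

lemma chordal_bdist_ge:
  assumes "open \<Omega>" "w \<in> \<Omega>" "frontier \<Omega> \<noteq> {}"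
  defines "d \<equiv> infdist w (frontier \<Omega>)" and "W \<equiv> sqrt (1 + (cmod w)\<^sup>2)"
  shows "ennreal (d / (W * (W + d))) \<le> chordal_bdist \<Omega> w"
  unfolding chordal_bdist_def
proof (intro INF_greatest ennreal_leI)
  fix b
  assume b: "b \<in> sphere_boundary \<Omega>"
  have d: "0 \<le> d"
    by (simp add: d_def infdist_nonneg)
  have W: "0 < W"
    unfolding W_def by (auto intro: add_pos_nonneg)
  show "d / (W * (W + d)) \<le> chordal_dist (Some w) b"
  proof (cases b)
    case None
    have "d / (W * (W + d)) \<le> 1 / W"
      using d W by (simp add: divide_simps)
    then show ?thesis
      using None by (simp add: W_def)
  next
    case (Some c)
    define x B where "x = cmod (w - c)" and "B = sqrt (1 + (cmod c)\<^sup>2)"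
    have "d \<le> x"
      using b infdist_le[of c "frontier \<Omega>" w] Some assms(1)
      by (simp add: Some_in_sphere_boundary_iff d_def x_def dist_norm)
    have B: "0 < B"
      unfolding B_def by (auto intro: add_pos_nonneg)
    \<comment> \<open>The triangle inequality in the plane for the vectors (1, |w|) and (0, x),
      whose lengths are \<open>W\<close> and \<open>x\<close>, combined with |c| \<le> |w| +
      x.\<close>
    have "B \<le> cmod (Complex 1 (cmod w)) + cmod (Complex 0 x)"
    proof -
      have "B \<le> cmod (Complex 1 (cmod w + x))"
        unfolding B_def complex_norm x_def
        using norm_triangle_ineq2[of c w] norm_minus_commute[of c w]
        by (auto intro!: power_mono)
      also have "Complex 1 (cmod w + x) = Complex 1 (cmod w) + Complex 0 x"
        by (simp add: complex_eq_iff)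
      finally show ?thesis
        using norm_triangle_ineq order_trans by blast
    qed
    then have "B \<le> W + x"
      by (simp add: complex_norm W_def x_def)
    then have "d * B \<le> x * (W + d)"
    proof -
      have "d * B \<le> d * (W + x)"
        using \<open>B \<le> W + x\<close> d by (intro mult_left_mono)
      also have "\<dots> \<le> x * (W + d)"
        using \<open>d \<le> x\<close> W by (simp add: algebra_simps mult_left_mono)
      finally show ?thesis .
    qed
    then have "d / (W * (W + d)) \<le> x / (W * B)"
      using d W B by (simp add: divide_simps mult_ac add_pos_nonneg)
    then show ?thesis
      using Some by (simp add: x_def W_def B_def real_sqrt_mult)
  qed
qed

text \<open>At d = 3 W the bound equals 1, so for smaller \<open>d\<close> it is trivial. For larger
  \<open>d\<close> each finite point \<open>e\<close> of the complement has |e| \<ge> d - W, and two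
  points are compared through infinity.\<close>

lemma chordal_diameter_complement_le:
  assumes "w \<in> \<Omega>"
  defines "d \<equiv> infdist w (frontier \<Omega>)" and "W \<equiv> sqrt (1 + (cmod w)\<^sup>2)"
  shows "chordal_diameter (sphere_complement \<Omega>) \<le> ennreal (4 * W / (W + d))"
  unfolding chordal_diameter_def
proof (intro SUP_least ennreal_leI)
  fix x y
  assume x: "x \<in> sphere_complement \<Omega>" and y: "y \<in> sphere_complement \<Omega>"
  have d: "0 \<le> d"
    by (simp add: d_def infdist_nonneg)
  have W: "1 \<le> W" "cmod w \<le> W"
    unfolding W_def by (auto intro: real_le_rsqrt)
  show "chordal_dist x y \<le> 4 * W / (W + d)"
  proof (cases "d \<le> 3 * W")
    case True
    then have "1 \<le> 4 * W / (W + d)"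
      using d W by (simp add: divide_simps)
    then show ?thesis
      using chordal_dist_le_1 order_trans by blast
  next
    case False
    have far: "chordal_dist (Some e) None \<le> 1 / (d - W)" if "e \<notin> \<Omega>" for e
    proof -
      have "d \<le> cmod (w - e)"
        using ball_infdist_frontier_subset[OF assms(1)] that
        by (force simp: d_def dist_norm not_less)
      then have "d - W \<le> cmod e"
        using norm_triangle_ineq4[of w e] W by linarith
      also have "\<dots> \<le> sqrt (1 + (cmod e)\<^sup>2)"
        by (rule real_le_rsqrt) simp
      finally show ?thesis
        using False W by (auto intro!: divide_left_mono mult_pos_pos)
    qed
    have far': "chordal_dist u None \<le> 1 / (d - W)" if "u \<in> sphere_complement \<Omega>" for u
      using that far False W by (cases u) (auto simp: sphere_complement_def)
    have sym: "chordal_dist None y = chordal_dist y None"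
      by (cases y) auto
    have "chordal_dist x y \<le> 2 / (d - W)"
      using chordal_dist_le_via_infinity[of x y] far'[OF x] far'[OF y] sym by simp
    also have "2 / (d - W) \<le> 4 * W / (W + d)"
    proof -
      \<comment> \<open>Equivalent to d \<ge> 3 W; the next step uses W \<ge> 1.\<close>
      have "2 * (W + d) \<le> 4 * (d - W)"
        using False by simp
      also have "\<dots> \<le> 4 * W * (d - W)"
        using False W by (intro mult_right_mono) auto
      finally show ?thesis
        using False W d by (simp add: divide_simps)
    qed
    finally show ?thesis .
  qed
qed

text \<open>The pointwise form of (iv), before multiplication by the density. Both preceding bounds
  carry the factor 1 / (W + d), and W^2 = 1 + |w|^2 makes the rest match.\<close>

lemma infdist_times_chordal_diameter_le:
  assumes "open \<Omega>" "w \<in> \<Omega>" "frontier \<Omega> \<noteq> {}"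
  shows "ennreal (infdist w (frontier \<Omega>)) * chordal_diameter (sphere_complement \<Omega>)
    \<le> 4 * (chordal_bdist \<Omega> w * ennreal (1 + (cmod w)\<^sup>2))"
proof -
  define d W where "d = infdist w (frontier \<Omega>)" and "W = sqrt (1 + (cmod w)\<^sup>2)"
  have d: "0 \<le> d"
    by (simp add: d_def infdist_nonneg)
  have W: "0 < W"
    unfolding W_def by (auto intro: add_pos_nonneg)
  have W2: "1 + (cmod w)\<^sup>2 = W * W"
    unfolding W_def by (simp add: add_nonneg_nonneg)
  have "ennreal d * chordal_diameter (sphere_complement \<Omega>) \<le> ennreal d * ennreal (4 * W / (W + d))"
    using chordal_diameter_complement_le[OF assms(2)]
    by (intro mult_left_mono) (auto simp: d_def W_def)
  also have "\<dots> = ennreal (4 * (d / (W * (W + d)) * (W * W)))"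
  proof -
    have "d * (4 * W / (W + d)) = 4 * (d / (W * (W + d)) * (W * W))"
      using d W by simp
    then show ?thesis
      using d W by (simp flip: ennreal_mult)
  qed
  also have "\<dots> = 4 * (ennreal (d / (W * (W + d))) * ennreal (W * W))"
  proof -
    have "ennreal (4 * (A * B)) = 4 * (ennreal A * ennreal B)" if "0 \<le> A" "0 \<le> B" for A B
      using that by (simp add: ennreal_mult)
    moreover have "0 \<le> d / (W * (W + d))" "0 \<le> W * W"
      using d W by auto
    ultimately show ?thesis
      by blast
  qed
  also have "\<dots> \<le> 4 * (chordal_bdist \<Omega> w * ennreal (W * W))"
    using chordal_bdist_ge[OF assms]
    by (intro mult_left_mono mult_right_mono) (auto simp: d_def W_def)
  finally show ?thesis
    by (simp add: d_def W2)
qed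

lemma chordal_diameter_complement_pos:
  assumes "a \<notin> \<Omega>"
  shows "0 < chordal_diameter (sphere_complement \<Omega>)"
proof -
  have "0 < ennreal (chordal_dist (Some a) None)"
    by (simp add: add_pos_nonneg)
  also have "\<dots> \<le> chordal_diameter (sphere_complement \<Omega>)"
    unfolding chordal_diameter_def
    by (intro SUP_upper2[of "Some a"] SUP_upper2[of None] order_refl)
       (use assms in \<open>auto simp: sphere_complement_def\<close>)
  finally show ?thesis .
qed

lemma ennreal_spherical_density:
  "ennreal (spherical_density \<Omega> z) = ennreal (1 + (cmod z)\<^sup>2) * ennreal (hyp_density \<Omega> z)"
  unfolding spherical_density_def
  by (intro ennreal_mult add_nonneg_nonneg hyp_density_nonneg) auto


section \<open>The domain constants\<close>

lemma C_hat_le_half: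
  assumes "hyperbolic_domain \<Omega>"
  shows "C_hat \<Omega> \<le> 1 / 2"
proof -
  note op = hyperbolic_domainD(1)[OF assms]
  obtain z0 where z0: "z0 \<in> \<Omega>"
    using hyperbolic_domainD(2)[OF assms] by blast
  define r where "r = infdist z0 (frontier \<Omega>)"
  obtain a where a: "a \<in> frontier \<Omega>" "r = dist z0 a"
    unfolding r_def using infdist_attains_inf[OF frontier_closed hyperbolic_domainD(3)[OF assms]] .
  have "a \<noteq> z0"
    using a(1) z0 op by (auto simp: frontier_def interior_open)
  then have r: "0 < r"
    using a(2) by simp
  define x where "x = (\<lambda>t::real. a + of_real t * (z0 - a))"
  \<comment> \<open>The point \<open>x t\<close> moves along the radius from \<open>a\<close> to the
    centre \<open>z0\<close>. \<open>\<phi> t\<close> is \<tau>(x t, a) times the spherical density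
    bound from \<open>ball z0 r\<close>; the factor t r cancels, leaving a finite limit as t tends
    to 0.\<close>
  define \<phi> where "\<phi> = (\<lambda>t. (1 + (cmod (x t))\<^sup>2) / (cmod (1 + x t * cnj a) * (2 - t)))"
  have a0: "cmod (1 + a * cnj a) = 1 + (cmod a)\<^sup>2"
  proof -
    have "1 + a * cnj a = of_real (1 + (cmod a)\<^sup>2)"
      using complex_norm_square[of a] by simp
    then show ?thesis
      by (metis abs_of_nonneg add_nonneg_nonneg norm_of_real zero_le_one zero_le_power2)
  qed
  have a_pos: "0 < 1 + (cmod a)\<^sup>2"
    by (intro add_pos_nonneg) auto
  have lim_x: "(x \<longlongrightarrow> a) (at_right 0)"
    unfolding x_def by (auto intro!: tendsto_eq_intros)
  have lim_den: "((\<lambda>t. cmod (1 + x t * cnj a)) \<longlongrightarrow> 1 + (cmod a)\<^sup>2) (at_right 0)"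
    using lim_x by (auto intro!: tendsto_eq_intros simp: a0)
  have lim: "(\<phi> \<longlongrightarrow> 1 / 2) (at_right 0)"
  proof -
    have "0 < (1 + (cmod a)\<^sup>2) * (2 - 0)"
      by (intro mult_pos_pos a_pos) simp
    note nz = less_imp_neq[OF this, symmetric]
    have "(\<phi> \<longlongrightarrow> (1 + (cmod a)\<^sup>2) / ((1 + (cmod a)\<^sup>2) * (2 - 0))) (at_right 0)"
      unfolding \<phi>_def by (intro tendsto_intros lim_x lim_den nz)
    moreover have "(1 + (cmod a)\<^sup>2) / ((1 + (cmod a)\<^sup>2) * (2 - 0)) = 1 / 2"
      by (subst nonzero_divide_mult_cancel_left[OF less_imp_neq[OF a_pos, symmetric]]) simp
    ultimately show ?thesis
      by (simp only:)
  qed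
  have "C_hat \<Omega> \<le> ennreal (\<phi> t)" if t: "0 < t" "t < 1" and den: "0 < cmod (1 + x t * cnj a)" for t
  proof -
    have "dist z0 (x t) = cmod (of_real (1 - t) * (z0 - a))"
      by (simp add: x_def dist_norm algebra_simps)
    then have dz: "dist z0 (x t) = (1 - t) * r"
      using t by (simp add: norm_mult a(2) dist_norm del: of_real_diff)
    have da: "cmod (x t - a) = t * r"
      using t by (simp add: x_def norm_mult a(2) dist_norm)
    have xb: "x t \<in> ball z0 r"
      using dz t r by simp
    have sub: "ball z0 r \<subseteq> \<Omega>"
      unfolding r_def by (rule ball_infdist_frontier_subset[OF z0])
    have "r\<^sup>2 - (dist z0 (x t))\<^sup>2 = r * (t * r * (2 - t))"
      unfolding dz by (simp add: power2_eq_square algebra_simps)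
    then have hyp: "hyp_density \<Omega> (x t) \<le> 1 / (t * r * (2 - t))"
      using hyp_density_le_ball[OF sub xb] r by simp
    have "C_hat \<Omega> \<le> tau_bdist \<Omega> (x t) * ennreal (spherical_density \<Omega> (x t))"
      unfolding C_hat_def using xb sub by (intro INF_lower) auto
    also have "\<dots> \<le> ennreal (t * r / cmod (1 + x t * cnj a)) *
        ennreal ((1 + (cmod (x t))\<^sup>2) * (1 / (t * r * (2 - t))))"
    proof (intro mult_mono ennreal_leI)
      have "tau_bdist \<Omega> (x t) \<le> tau_dist (Some (x t)) (Some a)"
        unfolding tau_bdist_def using a(1) op
        by (intro INF_lower) (simp add: Some_in_sphere_boundary_iff)
      also have "\<dots> = ennreal (t * r / cmod (1 + x t * cnj a))"
        unfolding tau_dist.simps da using den t r by (intro divide_ennreal) auto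
      finally show "tau_bdist \<Omega> (x t) \<le> ennreal (t * r / cmod (1 + x t * cnj a))" .
      show "spherical_density \<Omega> (x t) \<le> (1 + (cmod (x t))\<^sup>2) * (1 / (t * r * (2 - t)))"
        unfolding spherical_density_def using hyp
        by (intro mult_left_mono add_nonneg_nonneg) auto
    qed auto
    also have "\<dots> = ennreal (\<phi> t)"
      using t r den unfolding \<phi>_def by (subst ennreal_mult[symmetric]) auto
    finally show ?thesis .
  qed
  \<comment> \<open>Near \<open>a\<close> the point \<open>x t\<close> is not antipodal to
    \<open>a\<close>, so \<tau>(x t, a) is finite.\<close>
  moreover have "eventually (\<lambda>t. 0 < cmod (1 + x t * cnj a)) (at_right 0)"
    using order_tendstoD(1)[OF lim_den a_pos] .
  moreover have "eventually (\<lambda>t::real. 0 < t \<and> t < 1) (at_right 0)"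
    by (intro eventually_conj eventually_at_right_less eventually_at_rightI[of 0 1]) auto
  ultimately have "eventually (\<lambda>t. C_hat \<Omega> \<le> ennreal (\<phi> t)) (at_right 0)"
    by (auto elim: eventually_elim2)
  moreover have "((\<lambda>t. ennreal (\<phi> t)) \<longlongrightarrow> ennreal (1 / 2)) (at_right 0)"
    using lim by (rule tendsto_ennrealI)
  ultimately have "C_hat \<Omega> \<le> ennreal (1 / 2)"
    by (intro tendsto_lowerbound) auto
  also have "\<dots> = 1 / 2"
    by (simp add: divide_ennreal_def)
  finally show ?thesis .
qed

lemma C_tilde_le_C_hat: "C_tilde \<Omega> \<le> C_hat \<Omega>"
  unfolding C_tilde_def C_hat_def
  by (intro INF_mono' mult_right_mono chordal_bdist_le_tau_bdist) simp

lemma C_hat_le_C_eucl: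
  assumes "hyperbolic_domain \<Omega>"
  shows "C_hat \<Omega> \<le> 2 * C_eucl \<Omega>"
proof -
  \<comment> \<open>With the constant moved to the left, \<open>C_eucl\<close> stands alone as an
    infimum and a pointwise estimate suffices.\<close>
  have "C_hat \<Omega> / 2 \<le> C_eucl \<Omega>"
    unfolding C_eucl_def
  proof (rule INF_greatest)
    fix z
    assume z: "z \<in> \<Omega>"
    have "C_hat \<Omega> \<le> tau_bdist \<Omega> z * ennreal (1 + (cmod z)\<^sup>2) * ennreal (hyp_density \<Omega> z)"
      unfolding C_hat_def ennreal_spherical_density mult.assoc using z by (rule INF_lower)
    also have "\<dots> \<le> 2 * eucl_bdist \<Omega> z * ennreal (hyp_density \<Omega> z)"
      using tau_bdist_le_infdist[OF _ z] hyperbolic_domainD[OF assms]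
      by (intro mult_right_mono) (auto simp: eucl_bdist_eq_infdist)
    finally show "C_hat \<Omega> / 2 \<le> eucl_bdist \<Omega> z * ennreal (hyp_density \<Omega> z)"
      by (simp add: divide_le_posI_ennreal mult.assoc)
  qed
  then have "2 * (C_hat \<Omega> / 2) \<le> 2 * C_eucl \<Omega>"
    by (rule mult_left_mono) simp
  then show ?thesis
    by (simp add: ennreal_times_divide ennreal_mult_divide_eq mult.commute)
qed

lemma C_eucl_le_C_tilde':
  assumes "hyperbolic_domain \<Omega>"
  shows "C_eucl \<Omega> \<le> 4 * C_tilde' \<Omega>"
proof -
  define s where "s = chordal_diameter (sphere_complement \<Omega>)"
  note op = hyperbolic_domainD(1)[OF assms] and fr = hyperbolic_domainD(3)[OF assms]
  obtain a where "a \<in> frontier \<Omega>"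
    using fr by blast
  then have "a \<notin> \<Omega>"
    using op by (simp add: frontier_def interior_open)
  \<comment> \<open>Both facts are required to cancel \<open>s\<close> in \<open>ennreal\<close> at
    the end.\<close>
  then have s: "s \<noteq> 0" "s \<noteq> top"
  proof -
    show "s \<noteq> 0"
      using chordal_diameter_complement_pos[OF \<open>a \<notin> \<Omega>\<close>] by (simp add: s_def)
    have "s \<le> 1"
      unfolding s_def chordal_diameter_def
      by (intro SUP_least) (simp add: chordal_dist_le_1)
    then show "s \<noteq> top"
      by (metis ennreal_one_less_top leD)
  qed
  have "C_eucl \<Omega> * s / 4 \<le> C_tilde \<Omega>"
    unfolding C_tilde_def
  proof (rule INF_greatest)
    fix w
    assume w: "w \<in> \<Omega>"
    have "C_eucl \<Omega> * s \<le> ennreal (infdist w (frontier \<Omega>)) * ennreal (hyp_density \<Omega> w) * s"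
      unfolding C_eucl_def eucl_bdist_eq_infdist[OF op fr, symmetric]
      by (intro mult_right_mono INF_lower w) simp
    also have "\<dots> = ennreal (infdist w (frontier \<Omega>)) * s * ennreal (hyp_density \<Omega> w)"
      by (simp add: mult_ac)
    also have "\<dots> \<le> 4 * (chordal_bdist \<Omega> w * ennreal (1 + (cmod w)\<^sup>2)) * ennreal (hyp_density \<Omega> w)"
      unfolding s_def by (intro mult_right_mono infdist_times_chordal_diameter_le op w fr) simp
    also have "\<dots> = 4 * (chordal_bdist \<Omega> w * ennreal (spherical_density \<Omega> w))"
      by (simp add: ennreal_spherical_density mult_ac)
    finally show "C_eucl \<Omega> * s / 4 \<le> chordal_bdist \<Omega> w * ennreal (spherical_density \<Omega> w)"
      by (simp add: divide_le_posI_ennreal)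
  qed
  then have "4 * (C_eucl \<Omega> * s / 4) \<le> 4 * C_tilde \<Omega>"
    by (rule mult_left_mono) simp
  then have "C_eucl \<Omega> * s \<le> 4 * C_tilde \<Omega>"
    by (simp add: ennreal_times_divide ennreal_mult_divide_eq mult.commute)
  then have "C_eucl \<Omega> * s / s \<le> 4 * C_tilde \<Omega> / s"
    by (rule divide_right_mono_ennreal)
  then show ?thesis
    using s by (simp add: ennreal_mult_divide_eq C_tilde'_def s_def ennreal_times_divide)
qed

theorem theorem1p4:
  fixes \<Omega> :: "complex set"
  assumes "hyperbolic_domain \<Omega>"
  shows "C_hat \<Omega> \<le> 1 / 2
    \<and> (C_tilde \<Omega> \<le> C_hat \<Omega> \<and> C_tilde' \<Omega> \<le> C_hat' \<Omega>)
    \<and> C_hat \<Omega> \<le> 2 * C_eucl \<Omega>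
    \<and> (C_eucl \<Omega> \<le> 4 * C_tilde' \<Omega>
        \<and> 4 * C_tilde' \<Omega> = 4 * C_tilde \<Omega> / chordal_diameter (sphere_complement \<Omega>))"
proof (intro conjI)
  show "C_tilde' \<Omega> \<le> C_hat' \<Omega>"
    unfolding C_tilde'_def C_hat'_def
    by (intro divide_right_mono_ennreal C_tilde_le_C_hat)
  show "4 * C_tilde' \<Omega> = 4 * C_tilde \<Omega> / chordal_diameter (sphere_complement \<Omega>)"
    by (simp add: C_tilde'_def ennreal_times_divide)
qed (use assms in \<open>auto simp: C_hat_le_half C_tilde_le_C_hat C_hat_le_C_eucl C_eucl_le_C_tilde'\<close>)

end
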